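(* Under Assumption 1, the finite sample identified set for $\beta$ is $$\mathcal{B}_n^*=\Big\{b\in\mathcal B:\ \mathbb E[(2Y_i-1)1\{X_ib\ge0\}\mid\mathcal X_n]\ \ge\ 0\ \ge\ \mathbb E[(2Y_i-1)1\{X_ib\le0\}\mid\mathcal X_n]\ \text{ for every } i=1,\dots,n\Big\}.$$
   Context: Setting. $n,K\ge 1$ are integers; $Y_i\in\{0,1\}$, $X_i$ is a row vector in $\mathbb{R}^K$, $U_i$ is real valued, $i=1,\dots,n$; $\mathcal{X}_n\equiv(X_1,\dots,X_n)$. The analysis is conditional on $\mathcal{X}_n$ (it may be read for a fixed realization of $\mathcal{X}_n$). Assumption 1. (i) The random vectors $(Y_i,X_i,U_i)$, $i=1,\dots,n$, are defined on a probability space $(\Omega,\mathfrak F,\mathbb P)$, where $\mathfrak F$ contains the Borel sets on $\Omega$. (ii) $(Y_i,X_i)$, $i=1,\dots,n$, are observed. (iii) There is a column vector $\beta\in\mathbb{R}^K$ such that $\mathbb P(Y_i=1\{X_i\beta+U_i\ge 0\}\mid\mathcal X_n)=1$ and $\mathbb P(U_i\ge 0\mid\mathcal X_n)=1/2$ for every $i$. (iv) $\beta$ belongs to a known set $\mathcal B\subseteq\mathbb R^K$. (v) $1\{U_1\ge0\},\dots,1\{U_n\ge0\}$ are mutually independent conditional on $\mathcal X_n$. Definition. The finite sample identified set $\mathcal B_n^*$ for $\beta$ is the set of $b\in\mathcal B$ for which there exist random variables $\tilde Y_1,\dots,\tilde Y_n$ and $\tilde U_1,\dots,\tilde U_n$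 such that: (i) $\mathbb P(\tilde Y_i=1\{X_ib+\tilde U_i\ge0\}\mid\mathcal X_n)=1$ for every $i$; (ii) $(\tilde Y_1,\dots,\tilde Y_n)$ and $(Y_1,\dots,Y_n)$ have the same distribution conditional on $\mathcal X_n$; (iii) $\mathbb P(\tilde U_i\ge0\mid\mathcal X_n)=1/2$ for every $i$; (iv) $1\{\tilde U_1\ge0\},\dots,1\{\tilde U_n\ge0\}$ are mutually independent given $\mathcal X_n$. *)

theory Defs
  imports "HOL-Probability.Probability"
begin

definition gen_algebra ::
    "'a measure \<Rightarrow> nat \<Rightarrow> (nat \<Rightarrow> 'a \<Rightarrow> 'b::topological_space) \<Rightarrow> 'a measure" where
  "gen_algebra M n X =
     vimage_algebra (space M) (\<lambda>\<omega>. \<lambda>i\<in>{1..n}. X i \<omega>) (PiM {1..n} (\<lambda>_. borel))"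

text \<open>
  \<open>cprob M F P\<close> is a version of the conditional probability of the event \<open>P\<close> given
  the sub-sigma-algebra \<open>F\<close>. It is unique only up to null sets, so every statement about it
  is an almost sure one. If \<open>F = gen_algebra M n X\<close> and \<open>X\<close> is constant, then \<open>F\<close> is trivial
  and \<open>cprob M F P\<close> is almost surely the unconditional probability of \<open>P\<close>; this is the reading
  of the conditional statements for a fixed realization of \<open>X\<close>.
\<close>

definition cprob :: "'a measure \<Rightarrow> 'a measure \<Rightarrow> ('a \<Rightarrow> bool) \<Rightarrow> 'a \<Rightarrow> real" where
  "cprob M F P = real_cond_exp M F (indicator {\<omega> \<in> space M. P \<omega>})"

definition cond_indep_vars ::
    "'a measure \<Rightarrow> 'a measure \<Rightarrow> ('i \<Rightarrow> 'b measure) \<Rightarrow> ('i \<Rightarrow> 'a \<Rightarrow> 'b) \<Rightarrow> 'i set \<Rightarrow> bool" where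
  "cond_indep_vars M F N Z I \<longleftrightarrow>
     (\<forall>i\<in>I. Z i \<in> measurable M (N i)) \<and>
     (\<forall>J\<subseteq>I. J \<noteq> {} \<longrightarrow> finite J \<longrightarrow>
       (\<forall>A. (\<forall>j\<in>J. A j \<in> sets (N j)) \<longrightarrow>
         (AE \<omega> in M. cprob M F (\<lambda>\<omega>'. \<forall>j\<in>J. Z j \<omega>' \<in> A j) \<omega> =
                     (\<Prod>j\<in>J. cprob M F (\<lambda>\<omega>'. Z j \<omega>' \<in> A j) \<omega>))))"

definition cond_same_distr ::
    "'a measure \<Rightarrow> 'a measure \<Rightarrow> 'b measure \<Rightarrow> ('a \<Rightarrow> 'b) \<Rightarrow> ('a \<Rightarrow> 'b) \<Rightarrow> bool" where
  "cond_same_distr M F N Z Z' \<longleftrightarrow>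
     (\<forall>A\<in>sets N. AE \<omega> in M. cprob M F (\<lambda>\<omega>'. Z \<omega>' \<in> A) \<omega> = cprob M F (\<lambda>\<omega>'. Z' \<omega>' \<in> A) \<omega>)"

text \<open>
  The row vector \<open>X i\<close> times the column vector \<open>\<beta>\<close> is the inner product \<open>X i \<omega> \<bullet> \<beta>\<close>, and
  \<open>K\<close> is \<open>CARD('k)\<close>. That \<open>Y\<close> and \<open>X\<close> are observed while \<open>U\<close> is not is reflected in
  \<open>identified_set\<close> below, which depends on \<open>Y\<close> and \<open>X\<close> but not on \<open>U\<close>.
\<close>

locale binary_response_model = prob_space M
  for M :: "'a::topological_space measure" +
  fixes n :: nat
    and Y :: "nat \<Rightarrow> 'a \<Rightarrow> real"
    and X :: "nat \<Rightarrow> 'a \<Rightarrow> real ^ 'k"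
    and U :: "nat \<Rightarrow> 'a \<Rightarrow> real"
    and \<beta> :: "real ^ 'k"
    and B :: "(real ^ 'k) set"
  assumes n_pos: "n \<ge> 1"
    and borel_sets: "sets (restrict_space borel (space M)) \<subseteq> sets M"
    and Y_measurable: "\<And>i. i \<in> {1..n} \<Longrightarrow> Y i \<in> borel_measurable M"
    and X_measurable: "\<And>i. i \<in> {1..n} \<Longrightarrow> X i \<in> borel_measurable M"
    and U_measurable: "\<And>i. i \<in> {1..n} \<Longrightarrow> U i \<in> borel_measurable M"
    and Y_binary: "\<And>i \<omega>. i \<in> {1..n} \<Longrightarrow> \<omega> \<in> space M \<Longrightarrow> Y i \<omega> \<in> {0, 1}"
    and response: "\<And>i. i \<in> {1..n} \<Longrightarrow>
      AE \<omega> in M. cprob M (gen_algebra M n X)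
        (\<lambda>\<omega>'. Y i \<omega>' = of_bool (X i \<omega>' \<bullet> \<beta> + U i \<omega>' \<ge> 0)) \<omega> = 1"
    and median: "\<And>i. i \<in> {1..n} \<Longrightarrow>
      AE \<omega> in M. cprob M (gen_algebra M n X) (\<lambda>\<omega>'. U i \<omega>' \<ge> 0) \<omega> = 1 / 2"
    and parameter: "\<beta> \<in> B"
    and cond_indep: "cond_indep_vars M (gen_algebra M n X) (\<lambda>_. borel)
      (\<lambda>i \<omega>. of_bool (U i \<omega> \<ge> 0) :: real) {1..n}"

definition identified_set ::
    "'a measure \<Rightarrow> nat \<Rightarrow> (nat \<Rightarrow> 'a \<Rightarrow> real) \<Rightarrow> (nat \<Rightarrow> 'a \<Rightarrow> real ^ 'k) \<Rightarrow>
     (real ^ 'k) set \<Rightarrow> (real ^ 'k) set" where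
  "identified_set M n Y X B = {b \<in> B. \<exists>Y' U' :: nat \<Rightarrow> 'a \<Rightarrow> real.
     (\<forall>i\<in>{1..n}. Y' i \<in> borel_measurable M \<and> U' i \<in> borel_measurable M) \<and>
     (\<forall>i\<in>{1..n}. AE \<omega> in M. cprob M (gen_algebra M n X)
        (\<lambda>\<omega>'. Y' i \<omega>' = of_bool (X i \<omega>' \<bullet> b + U' i \<omega>' \<ge> 0)) \<omega> = 1) \<and>
     cond_same_distr M (gen_algebra M n X) (PiM {1..n} (\<lambda>_. borel))
       (\<lambda>\<omega>. \<lambda>i\<in>{1..n}. Y' i \<omega>) (\<lambda>\<omega>. \<lambda>i\<in>{1..n}. Y i \<omega>) \<and>
     (\<forall>i\<in>{1..n}. AE \<omega> in M. cprob M (gen_algebra M n X) (\<lambda>\<omega>'. U' i \<omega>' \<ge> 0) \<omega> = 1 / 2) \<and>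
     cond_indep_vars M (gen_algebra M n X) (\<lambda>_. borel)
       (\<lambda>i \<omega>. of_bool (U' i \<omega> \<ge> 0) :: real) {1..n}}"

end

(*
Only the latent signs matter: if Y = 1{X b + U >= 0} almost surely and V = 1{U >= 0}, then V <= Y
where X b >= 0 and Y <= V where X b <= 0. Conversely, given these two inequalities, a latent
variable with sign V that generates Y from X b can be written down pointwise. Since V is
conditionally fair, the inequalities imply the moment conditions.

For the converse, b can be rationalised with the original outcomes Y and the original signs V. Where
X b and X beta have the same strict sign, the inequalities for beta are those needed for b. Elsewhere
the moment condition for b and the inequality for beta point in opposite directions, so Y and V have
the same conditional mean while being ordered, and hence agree almost surely.
*)

theory Submission
  imports Defs
begin

section \<open>Comparison of conditional expectations on conditioning events\<close>

context sigma_finite_subalgebra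
begin

lemma sets_subalg: "A \<in> sets F \<Longrightarrow> A \<in> sets M"
  using subalg by (auto simp: subalgebra_def)

lemma space_subalg: "space F = space M"
  using subalg by (auto simp: subalgebra_def)

lemma real_cond_exp_indicator_mult:
  assumes "A \<in> sets F" "integrable M f"
  shows "AE \<omega> in M. real_cond_exp M F (\<lambda>\<omega>. indicator A \<omega> * f \<omega>) \<omega> =
    indicator A \<omega> * real_cond_exp M F f \<omega>"
  using assms integrable_mult_indicator[OF sets_subalg[OF assms(1)] assms(2)]
  by (intro real_cond_exp_mult) auto

text \<open>After multiplication by the indicator of \<open>A\<close> the order holds almost
  everywhere, and since \<open>A\<close> lies in \<open>F\<close> that indicator can be pulled back
  out of both conditional expectations. The local form is needed because the sign of the index
  varies with \<omega>.\<close>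

lemma real_cond_exp_mono_on:
  assumes A: "A \<in> sets F" and f: "integrable M f" and g: "integrable M g"
    and le: "AE \<omega> in M. \<omega> \<in> A \<longrightarrow> f \<omega> \<le> g \<omega>"
  shows "AE \<omega> in M. \<omega> \<in> A \<longrightarrow> real_cond_exp M F f \<omega> \<le> real_cond_exp M F g \<omega>"
proof -
  have "AE \<omega> in M. real_cond_exp M F (\<lambda>\<omega>. indicator A \<omega> * f \<omega>) \<omega> \<le>
      real_cond_exp M F (\<lambda>\<omega>. indicator A \<omega> * g \<omega>) \<omega>"
    using le integrable_mult_indicator[OF sets_subalg[OF A] f]
      integrable_mult_indicator[OF sets_subalg[OF A] g]
    by (intro real_cond_exp_mono) (auto simp: indicator_def elim!: eventually_mono)
  then show ?thesis
    using real_cond_exp_indicator_mult[OF A f] real_cond_exp_indicator_mult[OF A g]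
    by eventually_elim (auto simp: indicator_def)
qed

text \<open>Because \<open>A\<close> lies in \<open>F\<close>, integrating over \<open>A\<close>
  does not distinguish a function from its conditional expectation. Hence the integral of
  \<open>g\<close> over \<open>A\<close> is at most that of \<open>f\<close>, although
  \<open>g\<close> dominates \<open>f\<close> there; a nonnegative difference with integral zero
  vanishes almost everywhere.\<close>

lemma AE_eq_on_if_real_cond_exp_le:
  assumes A: "A \<in> sets F" and f: "integrable M f" and g: "integrable M g"
    and le: "AE \<omega> in M. \<omega> \<in> A \<longrightarrow> f \<omega> \<le> g \<omega>"
    and ge: "AE \<omega> in M. \<omega> \<in> A \<longrightarrow> real_cond_exp M F g \<omega> \<le> real_cond_exp M F f \<omega>"
  shows "AE \<omega> in M. \<omega> \<in> A \<longrightarrow> f \<omega> = g \<omega>"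
proof -
  have int: "integrable M (\<lambda>\<omega>. indicator A \<omega> * h \<omega>)" if "integrable M h" for h :: "'a \<Rightarrow> real"
    using integrable_mult_indicator[OF sets_subalg[OF A] that] by simp
  have "(\<integral>\<omega>. indicator A \<omega> * g \<omega> \<partial>M) = (\<integral>\<omega>. indicator A \<omega> * real_cond_exp M F g \<omega> \<partial>M)"
    using A g int[OF g] by (intro real_cond_exp_intg(2)[symmetric]) auto
  also have "\<dots> \<le> (\<integral>\<omega>. indicator A \<omega> * real_cond_exp M F f \<omega> \<partial>M)"
    using ge int[OF real_cond_exp_int(1)[OF f]] int[OF real_cond_exp_int(1)[OF g]]
    by (intro integral_mono_AE) (auto simp: indicator_def elim!: eventually_mono)
  also have "\<dots> = (\<integral>\<omega>. indicator A \<omega> * f \<omega> \<partial>M)"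
    using A f int[OF f] by (intro real_cond_exp_intg(2)) auto
  finally have ge': "(\<integral>\<omega>. indicator A \<omega> * g \<omega> \<partial>M) \<le> (\<integral>\<omega>. indicator A \<omega> * f \<omega> \<partial>M)" .
  have le': "AE \<omega> in M. indicator A \<omega> * f \<omega> \<le> indicator A \<omega> * g \<omega>"
    using le by eventually_elim (auto simp: indicator_def)
  have "AE \<omega> in M. indicator A \<omega> * f \<omega> = indicator A \<omega> * g \<omega>"
    using ge' integral_mono_AE[OF int[OF f] int[OF g] le']
    by (intro integral_ineq_eq_0_then_AE[OF le' int[OF f] int[OF g]]) auto
  then show ?thesis
    by eventually_elim (auto simp: indicator_def)
qed

end

text \<open>This turns the conditional response equations into almost sure ones. An indicator is at
  most 1, so if its conditional expectation is that of the constant 1, the equality lemma above with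
  \<open>A\<close> the whole space forces the two to agree.\<close>

lemma (in prob_space) cprob_eq_1_iff:
  assumes F: "subalgebra M F" and P[measurable]: "Measurable.pred M P"
  shows "(AE \<omega> in M. cprob M F P \<omega> = 1) \<longleftrightarrow> (AE \<omega> in M. P \<omega>)"
proof -
  interpret F: finite_measure_subalgebra M F
    by unfold_locales (rule F)
  have int: "integrable M (indicator {\<omega> \<in> space M. P \<omega>} :: 'a \<Rightarrow> real)"
    by (simp add: integrable_real_indicator emeasure_eq_measure)
  have const: "AE \<omega> in M. real_cond_exp M F (\<lambda>_. 1) \<omega> = 1"
    by (rule F.real_cond_exp_F_meas) simp_all
  show ?thesis
  proof
    assume "AE \<omega> in M. cprob M F P \<omega> = 1"
    then have "AE \<omega> in M. \<omega> \<in> space M \<longrightarrow>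
        real_cond_exp M F (\<lambda>_. 1) \<omega> \<le> real_cond_exp M F (indicator {\<omega> \<in> space M. P \<omega>}) \<omega>"
      using const by eventually_elim (simp add: cprob_def)
    then have "AE \<omega> in M. \<omega> \<in> space M \<longrightarrow> indicator {\<omega> \<in> space M. P \<omega>} \<omega> = (1::real)"
      using int sets.top[of F]
      by (intro F.AE_eq_on_if_real_cond_exp_le) (auto simp: F.space_subalg)
    then show "AE \<omega> in M. P \<omega>"
      using AE_space by eventually_elim (auto simp: indicator_def split: if_splits)
  next
    assume "AE \<omega> in M. P \<omega>"
    then have "AE \<omega> in M. indicator {\<omega> \<in> space M. P \<omega>} \<omega> = (1::real)"
      using AE_space by eventually_elim auto
    then have "AE \<omega> in M. cprob M F P \<omega> = real_cond_exp M F (\<lambda>_. 1) \<omega>"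
      unfolding cprob_def by (rule F.real_cond_exp_cong) measurable
    then show "AE \<omega> in M. cprob M F P \<omega> = 1"
      using const by eventually_elim simp
  qed
qed

text \<open>For binary \<open>Y\<close>, the factor \<open>2 * Y \<omega> - 1\<close> is affine in
  the indicator of \<open>Y \<omega> = 1\<close>. The event \<open>S\<close> belongs to
  \<open>F\<close> and so comes out of the conditional expectation, and linearity does the
  rest.\<close>

lemma (in finite_measure_subalgebra) real_cond_exp_binary_moment:
  assumes s: "Measurable.pred F S" and Y[measurable]: "Y \<in> borel_measurable M"
    and bin: "\<And>\<omega>. \<omega> \<in> space M \<Longrightarrow> Y \<omega> \<in> {0, 1 :: real}"
  shows "AE \<omega> in M. real_cond_exp M F (\<lambda>\<omega>. (2 * Y \<omega> - 1) * of_bool (S \<omega>)) \<omega> =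
    of_bool (S \<omega>) * (2 * cprob M F (\<lambda>\<omega>. Y \<omega> = 1) \<omega> - 1)"
proof -
  have [measurable]: "Measurable.pred M S"
    using measurable_from_subalg[OF subalg s] .
  define A where "A = {\<omega> \<in> space M. S \<omega>}"
  have A: "A \<in> sets F"
    using s unfolding A_def space_subalg[symmetric] by (simp add: pred_def)
  define I :: "'a \<Rightarrow> real" where "I = indicator {\<omega> \<in> space M. Y \<omega> = 1}"
  have I: "integrable M I"
    unfolding I_def by (simp add: integrable_real_indicator emeasure_eq_measure)
  have "AE \<omega> in M. (2 * Y \<omega> - 1) * of_bool (S \<omega>) = indicator A \<omega> * (2 * I \<omega> - 1)"
    using AE_space by eventually_elim (use bin in \<open>force simp: A_def I_def indicator_def\<close>)
  then have "AE \<omega> in M. real_cond_exp M F (\<lambda>\<omega>. (2 * Y \<omega> - 1) * of_bool (S \<omega>)) \<omega> =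
      real_cond_exp M F (\<lambda>\<omega>. indicator A \<omega> * (2 * I \<omega> - 1)) \<omega>"
    using I sets_subalg[OF A] by (intro real_cond_exp_cong) auto
  moreover have "AE \<omega> in M. real_cond_exp M F (\<lambda>\<omega>. indicator A \<omega> * (2 * I \<omega> - 1)) \<omega> =
      indicator A \<omega> * real_cond_exp M F (\<lambda>\<omega>. 2 * I \<omega> - 1) \<omega>"
    using I by (intro real_cond_exp_indicator_mult A) auto
  moreover have "AE \<omega> in M. real_cond_exp M F (\<lambda>\<omega>. 2 * I \<omega> - 1) \<omega> =
      real_cond_exp M F (\<lambda>\<omega>. 2 * I \<omega>) \<omega> - real_cond_exp M F (\<lambda>_. 1) \<omega>"
    using I by (intro real_cond_exp_diff) auto
  moreover have "AE \<omega> in M. real_cond_exp M F (\<lambda>\<omega>. 2 * I \<omega>) \<omega> = 2 * real_cond_exp M F I \<omega>"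
    using I by (intro real_cond_exp_cmult)
  moreover have "AE \<omega> in M. real_cond_exp M F (\<lambda>_. 1) \<omega> = (1::real)"
    by (intro real_cond_exp_F_meas) auto
  ultimately show ?thesis
    using AE_space unfolding cprob_def I_def[symmetric]
    by eventually_elim (auto simp: A_def indicator_def)
qed

section \<open>Pointwise threshold responses\<close>

lemma threshold_sign_order:
  fixes s u y :: real
  assumes "y = of_bool (s + u \<ge> 0)"
  shows "(s \<ge> 0 \<longrightarrow> u \<ge> 0 \<longrightarrow> y = 1) \<and> (s \<le> 0 \<longrightarrow> y = 1 \<longrightarrow> u \<ge> 0)"
  using assms by (auto split: if_splits simp: of_bool_def)

text \<open>The sign is prescribed by \<open>v\<close> in every branch, whatever \<open>s\<close>
  and \<open>y\<close> are. The size is chosen to produce \<open>y\<close>: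
  \<open>\<bar>s\<bar>\<close> lifts the sum to at least 0, \<open>- s\<close> brings a positive
  \<open>s\<close> exactly to the threshold, and \<open>- \<bar>s\<bar> - 1\<close> pushes the sum
  to at most -1. The value -1 for \<open>s \<le> 0\<close> only keeps the shock negative, since no
  negative shock can yield outcome 1 there.\<close>

definition threshold_shock :: "real \<Rightarrow> bool \<Rightarrow> real \<Rightarrow> real" where
  "threshold_shock s v y =
    (if v then if y = 1 then \<bar>s\<bar> else 0
     else if y = 1 then - (if s > 0 then s else 1) else - \<bar>s\<bar> - 1)"

lemma threshold_shock_nonneg_iff: "threshold_shock s v y \<ge> 0 \<longleftrightarrow> v"
  by (auto simp: threshold_shock_def)

text \<open>A converse to \<open>threshold_sign_order\<close>. The two implications exclude exactly
  the sign patterns that no shock could realise: a nonnegative shock with \<open>s \<ge> 0\<close>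
  and outcome 0, and a negative shock with \<open>s \<le> 0\<close> and outcome 1.\<close>

lemma threshold_shock_response:
  assumes "y \<in> {0, 1}" "s \<ge> 0 \<longrightarrow> v \<longrightarrow> y = 1" "s \<le> 0 \<longrightarrow> y = 1 \<longrightarrow> v"
  shows "y = of_bool (s + threshold_shock s v y \<ge> 0)"
proof (cases v)
  case True
  then show ?thesis
    using assms by (cases "y = 1") (auto simp: threshold_shock_def)
next
  case False
  then show ?thesis
    using assms by (cases "y = 1") (auto simp: threshold_shock_def not_le)
qed

section \<open>Conditional bounds and transfer of the sign order\<close>

context finite_measure_subalgebra
begin

text \<open>The sign order compares the indicators of \<open>Y \<omega> = 1\<close> and
  \<open>U \<omega> \<ge> 0\<close> on the events \<open>s \<omega> \<ge> 0\<close> and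
  \<open>s \<omega> \<le> 0\<close>. Both events lie in \<open>F\<close>, so the comparison passes
  to conditional probabilities, where the latent sign contributes 1/2.\<close>

lemma cprob_threshold_bounds:
  fixes s Y U :: "'a \<Rightarrow> real"
  assumes s[measurable]: "s \<in> borel_measurable F"
    and [measurable]: "Y \<in> borel_measurable M" "U \<in> borel_measurable M"
    and resp: "AE \<omega> in M. Y \<omega> = of_bool (s \<omega> + U \<omega> \<ge> 0)"
    and med: "AE \<omega> in M. cprob M F (\<lambda>\<omega>. U \<omega> \<ge> 0) \<omega> = 1 / 2"
  shows "AE \<omega> in M. (s \<omega> \<ge> 0 \<longrightarrow> cprob M F (\<lambda>\<omega>. Y \<omega> = 1) \<omega> \<ge> 1 / 2) \<and>
    (s \<omega> \<le> 0 \<longrightarrow> cprob M F (\<lambda>\<omega>. Y \<omega> = 1) \<omega> \<le> 1 / 2)"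
proof -
  define I :: "'a \<Rightarrow> real" where "I = indicator {\<omega> \<in> space M. Y \<omega> = 1}"
  define V :: "'a \<Rightarrow> real" where "V = indicator {\<omega> \<in> space M. U \<omega> \<ge> 0}"
  have int: "integrable M I" "integrable M V"
    unfolding I_def V_def by (simp_all add: integrable_real_indicator emeasure_eq_measure)
  have ord: "AE \<omega> in M. (s \<omega> \<ge> 0 \<longrightarrow> U \<omega> \<ge> 0 \<longrightarrow> Y \<omega> = 1) \<and> (s \<omega> \<le> 0 \<longrightarrow> Y \<omega> = 1 \<longrightarrow> U \<omega> \<ge> 0)"
    using resp by eventually_elim (rule threshold_sign_order)
  have "AE \<omega> in M. \<omega> \<in> {\<omega> \<in> space F. s \<omega> \<ge> 0} \<longrightarrow> V \<omega> \<le> I \<omega>"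
    using ord AE_space by eventually_elim (auto simp: V_def I_def indicator_def)
  then have "AE \<omega> in M. \<omega> \<in> {\<omega> \<in> space F. s \<omega> \<ge> 0} \<longrightarrow>
      real_cond_exp M F V \<omega> \<le> real_cond_exp M F I \<omega>"
    using int by (intro real_cond_exp_mono_on) auto
  moreover have "AE \<omega> in M. \<omega> \<in> {\<omega> \<in> space F. s \<omega> \<le> 0} \<longrightarrow> I \<omega> \<le> V \<omega>"
    using ord AE_space by eventually_elim (auto simp: V_def I_def indicator_def)
  then have "AE \<omega> in M. \<omega> \<in> {\<omega> \<in> space F. s \<omega> \<le> 0} \<longrightarrow>
      real_cond_exp M F I \<omega> \<le> real_cond_exp M F V \<omega>"
    using int by (intro real_cond_exp_mono_on) auto
  ultimately show ?thesis
    using med AE_space unfolding cprob_def I_def[symmetric] V_def[symmetric]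
    by eventually_elim (auto simp: space_subalg)
qed

text \<open>Here \<open>r\<close> is the index that generates \<open>Y\<close> and \<open>s\<close>
  is a candidate index. The same \<open>U\<close> is shown to stand in the order relation to
  \<open>Y\<close> that a threshold response with index \<open>s\<close> requires.\<close>

lemma sign_order_transfer:
  fixes r s Y U :: "'a \<Rightarrow> real"
  assumes [measurable]: "r \<in> borel_measurable F" "s \<in> borel_measurable F"
    and [measurable]: "Y \<in> borel_measurable M" "U \<in> borel_measurable M"
    and resp: "AE \<omega> in M. Y \<omega> = of_bool (r \<omega> + U \<omega> \<ge> 0)"
    and med: "AE \<omega> in M. cprob M F (\<lambda>\<omega>. U \<omega> \<ge> 0) \<omega> = 1 / 2"
    and bounds: "AE \<omega> in M. (s \<omega> \<ge> 0 \<longrightarrow> cprob M F (\<lambda>\<omega>. Y \<omega> = 1) \<omega> \<ge> 1 / 2) \<and>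
      (s \<omega> \<le> 0 \<longrightarrow> cprob M F (\<lambda>\<omega>. Y \<omega> = 1) \<omega> \<le> 1 / 2)"
  shows "AE \<omega> in M. (s \<omega> \<ge> 0 \<longrightarrow> U \<omega> \<ge> 0 \<longrightarrow> Y \<omega> = 1) \<and> (s \<omega> \<le> 0 \<longrightarrow> Y \<omega> = 1 \<longrightarrow> U \<omega> \<ge> 0)"
proof -
  define I :: "'a \<Rightarrow> real" where "I = indicator {\<omega> \<in> space M. Y \<omega> = 1}"
  define V :: "'a \<Rightarrow> real" where "V = indicator {\<omega> \<in> space M. U \<omega> \<ge> 0}"
  have int: "integrable M I" "integrable M V"
    unfolding I_def V_def by (simp_all add: integrable_real_indicator emeasure_eq_measure)
  have ord: "AE \<omega> in M. (r \<omega> \<ge> 0 \<longrightarrow> U \<omega> \<ge> 0 \<longrightarrow> Y \<omega> = 1) \<and> (r \<omega> \<le> 0 \<longrightarrow> Y \<omega> = 1 \<longrightarrow> U \<omega> \<ge> 0)"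
    using resp by eventually_elim (rule threshold_sign_order)
  \<comment> \<open>On this event \<open>r\<close> orders the indicators one way, while the bound
    for \<open>s\<close> orders their conditional means the other way. This forces equality; the
    event with both signs reversed is symmetric.\<close>
  have "AE \<omega> in M. \<omega> \<in> {\<omega> \<in> space F. r \<omega> \<ge> 0 \<and> s \<omega> \<le> 0} \<longrightarrow> V \<omega> \<le> I \<omega>"
    using ord AE_space by eventually_elim (auto simp: V_def I_def indicator_def)
  moreover have "AE \<omega> in M. \<omega> \<in> {\<omega> \<in> space F. r \<omega> \<ge> 0 \<and> s \<omega> \<le> 0} \<longrightarrow>
      real_cond_exp M F I \<omega> \<le> real_cond_exp M F V \<omega>"
    using bounds med unfolding cprob_def I_def[symmetric] V_def[symmetric]
    by eventually_elim auto
  ultimately have "AE \<omega> in M. \<omega> \<in> {\<omega> \<in> space F. r \<omega> \<ge> 0 \<and> s \<omega> \<le> 0} \<longrightarrow> V \<omega> = I \<omega>"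
    using int by (intro AE_eq_on_if_real_cond_exp_le) auto
  moreover have "AE \<omega> in M. \<omega> \<in> {\<omega> \<in> space F. r \<omega> \<le> 0 \<and> s \<omega> \<ge> 0} \<longrightarrow> I \<omega> = V \<omega>"
  proof -
    have "AE \<omega> in M. \<omega> \<in> {\<omega> \<in> space F. r \<omega> \<le> 0 \<and> s \<omega> \<ge> 0} \<longrightarrow> I \<omega> \<le> V \<omega>"
      using ord AE_space by eventually_elim (auto simp: V_def I_def indicator_def)
    moreover have "AE \<omega> in M. \<omega> \<in> {\<omega> \<in> space F. r \<omega> \<le> 0 \<and> s \<omega> \<ge> 0} \<longrightarrow>
        real_cond_exp M F V \<omega> \<le> real_cond_exp M F I \<omega>"
      using bounds med unfolding cprob_def I_def[symmetric] V_def[symmetric]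
      by eventually_elim auto
    ultimately show ?thesis
      using int by (intro AE_eq_on_if_real_cond_exp_le) auto
  qed
  \<comment> \<open>Split on the sign of \<open>r \<omega>\<close>: where it weakly agrees with that
    of \<open>s \<omega>\<close>, the order for \<open>r\<close> is the one wanted, and otherwise
    \<open>V\<close> and \<open>I\<close> coincide. Weak inequalities in both events take care of
    zero indices.\<close>
  ultimately show ?thesis
    using ord AE_space
  proof eventually_elim
    case (elim \<omega>)
    then show ?case
      using linear[of "r \<omega>" 0]
      by (auto simp: V_def I_def space_subalg indicator_def split: if_splits)
  qed
qed

end

section \<open>Conditioning on the covariates, and the identified set\<close>

lemma subalgebra_gen_algebra:
  assumes "\<And>i. i \<in> {1..n} \<Longrightarrow> X i \<in> borel_measurable M"
  shows "subalgebra M (gen_algebra M n X)"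
proof -
  have "(\<lambda>\<omega>. \<lambda>i\<in>{1..n}. X i \<omega>) \<in> measurable M (PiM {1..n} (\<lambda>_. borel))"
    using assms by (rule measurable_restrict)
  then show ?thesis
    unfolding subalgebra_def gen_algebra_def by (simp add: sets_image_in_sets)
qed

lemma measurable_gen_algebra:
  assumes "i \<in> {1..n}"
  shows "X i \<in> borel_measurable (gen_algebra M n X)"
proof -
  have "(\<lambda>\<omega>. \<lambda>i\<in>{1..n}. X i \<omega>) \<in>
      measurable (gen_algebra M n X) (PiM {1..n} (\<lambda>_. borel))"
    unfolding gen_algebra_def
    by (rule measurable_vimage_algebra1) (auto simp: space_PiM)
  from measurable_compose[OF this measurable_component_singleton[OF assms]]
  show ?thesis
    using assms by simp
qed

text \<open>Equality of the conditional joint laws is evaluated on the cylinder over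
  \<open>A\<close>, which gives the conditional marginals.\<close>

lemma cond_same_distr_component:
  assumes same: "cond_same_distr M F (PiM I N) (\<lambda>\<omega>. \<lambda>i\<in>I. Z i \<omega>) (\<lambda>\<omega>. \<lambda>i\<in>I. Z' i \<omega>)"
    and i: "i \<in> I" and A: "A \<in> sets (N i)"
    and Z: "\<And>j. j \<in> I \<Longrightarrow> Z j \<in> measurable M (N j)"
    and Z': "\<And>j. j \<in> I \<Longrightarrow> Z' j \<in> measurable M (N j)"
  shows "AE \<omega> in M. cprob M F (\<lambda>\<omega>. Z i \<omega> \<in> A) \<omega> = cprob M F (\<lambda>\<omega>. Z' i \<omega> \<in> A) \<omega>"
proof -
  let ?A = "(\<lambda>x. x i) -` A \<inter> space (PiM I N)"
  have "?A \<in> sets (PiM I N)"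
    using i A by (intro measurable_sets[OF measurable_component_singleton])
  then have *: "AE \<omega> in M. cprob M F (\<lambda>\<omega>. (\<lambda>i\<in>I. Z i \<omega>) \<in> ?A) \<omega> =
      cprob M F (\<lambda>\<omega>. (\<lambda>i\<in>I. Z' i \<omega>) \<in> ?A) \<omega>"
    using same unfolding cond_same_distr_def by blast
  \<comment> \<open>The cylinder is cut down to the product space, so the identity also uses that
    every other component takes values in its own space; measurability supplies this.\<close>
  have "{\<omega> \<in> space M. (\<lambda>i\<in>I. W i \<omega>) \<in> ?A} = {\<omega> \<in> space M. W i \<omega> \<in> A}"
    if "\<And>j. j \<in> I \<Longrightarrow> W j \<in> measurable M (N j)" for W
    using i measurable_space[OF that] by (auto simp: space_PiM)
  from this[OF Z] this[OF Z'] show ?thesis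
    using * by (simp add: cprob_def)
qed

theorem theorem1:
  fixes M :: "'a::topological_space measure"
    and n :: nat
    and Y U :: "nat \<Rightarrow> 'a \<Rightarrow> real"
    and X :: "nat \<Rightarrow> 'a \<Rightarrow> real ^ 'k"
    and \<beta> :: "real ^ 'k"
    and B :: "(real ^ 'k) set"
  assumes "binary_response_model M n Y X U \<beta> B"
  shows "identified_set M n Y X B =
    {b \<in> B. \<forall>i\<in>{1..n}. AE \<omega> in M.
       real_cond_exp M (gen_algebra M n X)
         (\<lambda>\<omega>'. (2 * Y i \<omega>' - 1) * of_bool (X i \<omega>' \<bullet> b \<ge> 0)) \<omega> \<ge> 0 \<and>
       0 \<ge> real_cond_exp M (gen_algebra M n X)
         (\<lambda>\<omega>'. (2 * Y i \<omega>' - 1) * of_bool (X i \<omega>' \<bullet> b \<le> 0)) \<omega>}"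
proof -
  interpret binary_response_model M n Y X U \<beta> B by fact
  define F where "F = gen_algebra M n X"
  have sub: "subalgebra M F"
    unfolding F_def by (rule subalgebra_gen_algebra) (rule X_measurable)
  interpret F: finite_measure_subalgebra M F
    by unfold_locales (rule sub)
  have XF: "(\<lambda>\<omega>. X i \<omega> \<bullet> c) \<in> borel_measurable F" if "i \<in> {1..n}" for i c
    using measurable_gen_algebra[OF that, of X M] unfolding F_def
    by (intro borel_measurable_inner borel_measurable_const)
  note XM = measurable_from_subalg[OF sub XF]
  note cprob_1 = cprob_eq_1_iff[OF sub]

  \<comment> \<open>Once both moments are replaced by their closed forms, the claim is pointwise:
    the sign factor makes an inequality trivial off its event, and on the event the moment has the
    sign of the conditional probability minus 1/2.\<close>
  have moments_iff: "(AE \<omega> in M.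
       real_cond_exp M F (\<lambda>\<omega>. (2 * Y i \<omega> - 1) * of_bool (X i \<omega> \<bullet> b \<ge> 0)) \<omega> \<ge> 0 \<and>
       0 \<ge> real_cond_exp M F (\<lambda>\<omega>. (2 * Y i \<omega> - 1) * of_bool (X i \<omega> \<bullet> b \<le> 0)) \<omega>) \<longleftrightarrow>
     (AE \<omega> in M. (X i \<omega> \<bullet> b \<ge> 0 \<longrightarrow> cprob M F (\<lambda>\<omega>. Y i \<omega> = 1) \<omega> \<ge> 1 / 2) \<and>
       (X i \<omega> \<bullet> b \<le> 0 \<longrightarrow> cprob M F (\<lambda>\<omega>. Y i \<omega> = 1) \<omega> \<le> 1 / 2))"
    if i: "i \<in> {1..n}" for i b
  proof (rule eventually_cong)
    note [measurable] = XF[OF i, of b]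
    note moment = F.real_cond_exp_binary_moment[OF _ Y_measurable[OF i] Y_binary[OF i]]
    show "AE \<omega> in M.
        real_cond_exp M F (\<lambda>\<omega>. (2 * Y i \<omega> - 1) * of_bool (X i \<omega> \<bullet> b \<ge> 0)) \<omega> =
          of_bool (X i \<omega> \<bullet> b \<ge> 0) * (2 * cprob M F (\<lambda>\<omega>. Y i \<omega> = 1) \<omega> - 1) \<and>
        real_cond_exp M F (\<lambda>\<omega>. (2 * Y i \<omega> - 1) * of_bool (X i \<omega> \<bullet> b \<le> 0)) \<omega> =
          of_bool (X i \<omega> \<bullet> b \<le> 0) * (2 * cprob M F (\<lambda>\<omega>. Y i \<omega> = 1) \<omega> - 1)"
      by (intro AE_conjI moment) measurable
  qed (auto simp: of_bool_def)

  have U_resp: "AE \<omega> in M. Y i \<omega> = of_bool (X i \<omega> \<bullet> \<beta> + U i \<omega> \<ge> 0)" if i: "i \<in> {1..n}" for i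
  proof -
    note [measurable] = Y_measurable[OF i] U_measurable[OF i] XM[OF i, of \<beta>]
    show ?thesis
      using response[OF i, folded F_def] by (rule cprob_1[THEN iffD1, rotated]) measurable
  qed

  \<comment> \<open>Both sets are cut out of \<open>B\<close>, so by \<open>moments_iff\<close> it
    remains to match the rationalisability condition with the probability bounds for each
    \<open>b\<close>.\<close>
  have "(\<exists>Y' U' :: nat \<Rightarrow> 'a \<Rightarrow> real.
     (\<forall>i\<in>{1..n}. Y' i \<in> borel_measurable M \<and> U' i \<in> borel_measurable M) \<and>
     (\<forall>i\<in>{1..n}. AE \<omega> in M. cprob M F
        (\<lambda>\<omega>'. Y' i \<omega>' = of_bool (X i \<omega>' \<bullet> b + U' i \<omega>' \<ge> 0)) \<omega> = 1) \<and>
     cond_same_distr M F (PiM {1..n} (\<lambda>_. borel))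
       (\<lambda>\<omega>. \<lambda>i\<in>{1..n}. Y' i \<omega>) (\<lambda>\<omega>. \<lambda>i\<in>{1..n}. Y i \<omega>) \<and>
     (\<forall>i\<in>{1..n}. AE \<omega> in M. cprob M F (\<lambda>\<omega>'. U' i \<omega>' \<ge> 0) \<omega> = 1 / 2) \<and>
     cond_indep_vars M F (\<lambda>_. borel)
       (\<lambda>i \<omega>. of_bool (U' i \<omega> \<ge> 0) :: real) {1..n}) \<longleftrightarrow>
    (\<forall>i\<in>{1..n}. AE \<omega> in M. (X i \<omega> \<bullet> b \<ge> 0 \<longrightarrow> cprob M F (\<lambda>\<omega>. Y i \<omega> = 1) \<omega> \<ge> 1 / 2) \<and>
       (X i \<omega> \<bullet> b \<le> 0 \<longrightarrow> cprob M F (\<lambda>\<omega>. Y i \<omega> = 1) \<omega> \<le> 1 / 2))"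
    (is "?ex \<longleftrightarrow> ?bounds") for b
  proof
    assume ?ex
    then show ?bounds
    proof (elim exE conjE, intro ballI)
      fix Y' U' :: "nat \<Rightarrow> 'a \<Rightarrow> real" and i
      assume "\<forall>i\<in>{1..n}. Y' i \<in> borel_measurable M \<and> U' i \<in> borel_measurable M"
        and resp: "\<forall>i\<in>{1..n}. AE \<omega> in M. cprob M F
          (\<lambda>\<omega>'. Y' i \<omega>' = of_bool (X i \<omega>' \<bullet> b + U' i \<omega>' \<ge> 0)) \<omega> = 1"
        and same: "cond_same_distr M F (PiM {1..n} (\<lambda>_. borel))
          (\<lambda>\<omega>. \<lambda>i\<in>{1..n}. Y' i \<omega>) (\<lambda>\<omega>. \<lambda>i\<in>{1..n}. Y i \<omega>)"
        and med: "\<forall>i\<in>{1..n}. AE \<omega> in M. cprob M F (\<lambda>\<omega>'. U' i \<omega>' \<ge> 0) \<omega> = 1 / 2"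
        and i: "i \<in> {1..n}"
      then have meas: "Y' j \<in> borel_measurable M" "U' j \<in> borel_measurable M"
        if "j \<in> {1..n}" for j
        using that by blast+
      note [measurable] = meas[OF i] XM[OF i, of b]
      have "AE \<omega> in M. Y' i \<omega> = of_bool (X i \<omega> \<bullet> b + U' i \<omega> \<ge> 0)"
        using bspec[OF resp i] by (rule cprob_1[THEN iffD1, rotated]) measurable
      from F.cprob_threshold_bounds[OF XF[OF i] meas[OF i] this bspec[OF med i]]
      have "AE \<omega> in M. (X i \<omega> \<bullet> b \<ge> 0 \<longrightarrow> cprob M F (\<lambda>\<omega>. Y' i \<omega> = 1) \<omega> \<ge> 1 / 2) \<and>
         (X i \<omega> \<bullet> b \<le> 0 \<longrightarrow> cprob M F (\<lambda>\<omega>. Y' i \<omega> = 1) \<omega> \<le> 1 / 2)" .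
      \<comment> \<open>The bounds so far concern \<open>Y'\<close>. Writing the event through the
        Borel set \<open>{1}\<close> lets the common conditional law carry them over to
        \<open>Y\<close>.\<close>
      moreover have "AE \<omega> in M. cprob M F (\<lambda>\<omega>. Y' i \<omega> \<in> {1}) \<omega> = cprob M F (\<lambda>\<omega>. Y i \<omega> \<in> {1}) \<omega>"
        by (rule cond_same_distr_component[OF same i]) (use meas Y_measurable in auto)
      ultimately show "AE \<omega> in M. (X i \<omega> \<bullet> b \<ge> 0 \<longrightarrow> cprob M F (\<lambda>\<omega>. Y i \<omega> = 1) \<omega> \<ge> 1 / 2) \<and>
         (X i \<omega> \<bullet> b \<le> 0 \<longrightarrow> cprob M F (\<lambda>\<omega>. Y i \<omega> = 1) \<omega> \<le> 1 / 2)"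
        by eventually_elim auto
    qed
  next
    assume bounds: ?bounds
    \<comment> \<open>The outcomes \<open>Y\<close> serve as their own witness; each shock keeps the
      sign of \<open>U i\<close> and is resized to fit the index for \<open>b\<close>.\<close>
    define U' where "U' i \<omega> = threshold_shock (X i \<omega> \<bullet> b) (U i \<omega> \<ge> 0) (Y i \<omega>)" for i \<omega>
    have sign: "U' i \<omega> \<ge> 0 \<longleftrightarrow> U i \<omega> \<ge> 0" for i \<omega>
      by (simp add: U'_def threshold_shock_nonneg_iff)
    have U'_meas: "U' i \<in> borel_measurable M" if i: "i \<in> {1..n}" for i
    proof -
      note [measurable] = Y_measurable[OF i] U_measurable[OF i] XM[OF i, of b]
      show ?thesis
        unfolding U'_def threshold_shock_def by measurable
    qed
    have "AE \<omega> in M. cprob M F (\<lambda>\<omega>'. Y i \<omega>' = of_bool (X i \<omega>' \<bullet> b + U' i \<omega>' \<ge> 0)) \<omega> = 1"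
      if i: "i \<in> {1..n}" for i
    proof -
      note [measurable] = Y_measurable[OF i] U'_meas[OF i] XM[OF i, of b]
      \<comment> \<open>The transfer is applied from the true index
        \<open>X i \<omega> \<bullet> \<beta>\<close> to the candidate
        \<open>X i \<omega> \<bullet> b\<close>.\<close>
      have "AE \<omega> in M. (X i \<omega> \<bullet> b \<ge> 0 \<longrightarrow> U i \<omega> \<ge> 0 \<longrightarrow> Y i \<omega> = 1) \<and>
          (X i \<omega> \<bullet> b \<le> 0 \<longrightarrow> Y i \<omega> = 1 \<longrightarrow> U i \<omega> \<ge> 0)"
        using bounds i median[OF i, folded F_def]
        by (intro F.sign_order_transfer[OF XF[OF i] XF[OF i] Y_measurable[OF i] U_measurable[OF i]
              U_resp[OF i]]) auto
      then have "AE \<omega> in M. Y i \<omega> = of_bool (X i \<omega> \<bullet> b + U' i \<omega> \<ge> 0)"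
        using AE_space
      proof eventually_elim
        case (elim \<omega>)
        then show ?case
          unfolding U'_def using Y_binary[OF i] by (intro threshold_shock_response) auto
      qed
      then show ?thesis
        by (rule cprob_1[THEN iffD2, rotated]) measurable
    qed
    \<comment> \<open>The signs of \<open>U'\<close> and \<open>U\<close> agree at every point, so
      the median and independence conditions are those of the model; equality of laws is reflexive
      because the outcomes are unchanged.\<close>
    then show ?ex
      using Y_measurable U'_meas median[folded F_def] cond_indep[folded F_def]
      by (intro exI[of _ Y] exI[of _ U']) (simp add: sign cond_same_distr_def)
  qed
  then show ?thesis
    unfolding identified_set_def F_def[symmetric] using moments_iff by auto
qed

end
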